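(* Let $f=(f_1,\dots,f_p)\colon(\mathbb C^n,0)\to(\mathbb C^p,0)$ be a holomorphic map-germ of finite $\mathscr A_e$-codimension $k$ which admits a 1-parameter stable unfolding $(f(x)+\lambda\gamma(x),\lambda)$ with $\gamma(x)=(0,\dots,0,x^\alpha)$, where $x^\alpha\in\mathfrak m_n$ is a monomial. Assume that one can choose functions $s_1,\dots,s_{k-1}\in\mathfrak m_p$ which do not depend on the last variable $X_p$ (so that $s_i(f(x))$ depends only on $f_1(x),\dots,f_{p-1}(x)$) such that every 1-parameter stable unfolding of $f$ is $\phi$-equivalent to one of the form $$\Big(f(x)+\Big(1+\sum_{i=1}^{k-1}q_i(\lambda)s_i(f(x))\Big)\lambda\gamma(x),\ \lambda\Big)$$ for some $q_1,\dots,q_{k-1}\in\mathcal O_1$. Then all 1-parameter stable unfoldings of $f$ are weak equivalent to each other.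
   Context: $\mathcal O_s$ is the ring of germs at $0$ of holomorphic functions on $\mathbb C^s$, $\mathfrak m_s$ its maximal ideal, $\theta_s$ the module of germs of holomorphic vector fields. For $f\colon(\mathbb C^n,0)\to(\mathbb C^p,0)$, $\theta(f)\cong\mathcal O_n^p$ is the module of vector fields along $f$ and the $\mathscr A_e$-codimension of $f$ is $\dim_{\mathbb C}\theta(f)/(df(\theta_n)+\{\eta\circ f:\eta\in\theta_p\})$; $f$ is stable if it is $0$. A 1-parameter stable unfolding (OPSU) of $f$ is a stable map-germ $F\colon(\mathbb C^n\times\mathbb C,0)\to(\mathbb C^p\times\mathbb C,0)$ of the form $F(x,\lambda)=(f_\lambda(x),\lambda)$ with $f_0=f$. Two OPSUs $F,F'$ are $\phi$-equivalent (with $\phi(x,\lambda)=\lambda$) if there are germs of biholomorphisms $h$ of $(\mathbb C^n\times\mathbb C,0)$, $k$ of $(\mathbb C^p\times\mathbb C,0)$, $l$ of $(\mathbb C,0)$ with $F'\circ h=k\circ F$ and $\pi\circ k=l\circ\pi$, where $\pi\colon\mathbb C^p\times\mathbb C\to\mathbb C$ is the projection. Two map-germs $F,G\colon(\mathbb C^n\times\mathbb C,0)\to(\mathbb C^p\times\mathbb C,0)$ are weak equivalent if there are germs of biholomorphisms $\Phi$ of $(\mathbb C^n\times\mathbb C,0)$ (coordinates $(x,\lambda)$) and $\Psi$ of $(\mathbb C^p\times\mathbb C,0)$ (coordinates $(X,\Lambda)$) with $G\circ\Phi=\Psi\circ F$, such that the last component of $\Phi$ is a multiple of $\lambda$ in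 $\mathcal O_{n+1}$ and the last component of $\Psi$ is a multiple of $\Lambda$ in $\mathcal O_{p+1}$. *)

theory Defs
  imports "HOL-Analysis.Analysis"
begin

(* Finite-dimensional complex vector spaces. The class gives a uniform treatment of C, of
   complex ^ 'n and of products such as (complex ^ 'n) \<times> complex. *)
class complex_space = euclidean_space +
  fixes scaleC :: "complex \<Rightarrow> 'a \<Rightarrow> 'a"
  assumes scaleC_add_right: "scaleC c (x + y) = scaleC c x + scaleC c y"
    and scaleC_add_left: "scaleC (c + d) x = scaleC c x + scaleC d x"
    and scaleC_scaleC: "scaleC c (scaleC d x) = scaleC (c * d) x"
    and scaleC_of_real: "scaleC (of_real r) x = scaleR r x"

instantiation complex :: complex_space
begin
definition scaleC_complex :: "complex \<Rightarrow> complex \<Rightarrow> complex"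
  where "scaleC_complex c x = c * x"
instance
  by standard (simp_all add: scaleC_complex_def algebra_simps scaleR_conv_of_real)
end

instantiation prod :: (complex_space, complex_space) complex_space
begin
definition scaleC_prod :: "complex \<Rightarrow> 'a \<times> 'b \<Rightarrow> 'a \<times> 'b"
  where "scaleC_prod c z = (scaleC c (fst z), scaleC c (snd z))"
instance
  by standard
    (simp_all add: scaleC_prod_def prod_eq_iff scaleC_add_right scaleC_add_left
      scaleC_scaleC scaleC_of_real)
end

instantiation vec :: (complex_space, finite) complex_space
begin
definition scaleC_vec :: "complex \<Rightarrow> 'a ^ 'b \<Rightarrow> 'a ^ 'b"
  where "scaleC_vec c v = (\<chi> i. scaleC c (v $ i))"
instance
  by standard
    (simp_all add: scaleC_vec_def vec_eq_iff scaleC_add_right scaleC_add_left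
      scaleC_scaleC scaleC_of_real)
end

lemma scaleC_vec_eq_vector_scalar_mult: "scaleC c (v :: complex ^ 'n) = c *s v"
  by (simp add: scaleC_vec_def scaleC_complex_def vec_eq_iff)

(* Germs at 0 are represented by total functions, and equality of germs is equality
   eventually in nhds 0; only the behaviour near 0 is ever used.
   Holomorphic means complex (Frechet) differentiable at every point near 0. *)
definition hol_germ :: "('a::complex_space \<Rightarrow> 'b::complex_space) \<Rightarrow> bool"
  where "hol_germ g \<longleftrightarrow>
    (\<forall>\<^sub>F x in nhds 0. \<exists>D. (g has_derivative D) (at x) \<and>
       (\<forall>c v. D (scaleC c v) = scaleC c (D v)))"

lemma hol_germ_complex_iff_analytic: "hol_germ (g :: complex \<Rightarrow> complex) \<longleftrightarrow> g analytic_on {0}"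
proof -
  have "(\<exists>D. (g has_derivative D) (at x) \<and> (\<forall>c v. D (scaleC c v) = scaleC c (D v)))
      \<longleftrightarrow> g field_differentiable at x" for x
  proof
    assume "\<exists>D. (g has_derivative D) (at x) \<and> (\<forall>c v. D (scaleC c v) = scaleC c (D v))"
    then obtain D where D: "(g has_derivative D) (at x)" "\<And>c v. D (c * v) = c * D v"
      by (auto simp: scaleC_complex_def)
    have "D v = D 1 * v" for v
      using D(2)[of v 1] by simp
    then have "D = (*) (D 1)"
      by (rule ext)
    with D(1) have "(g has_field_derivative D 1) (at x)"
      unfolding has_field_derivative_def by simp
    then show "g field_differentiable at x"
      by (auto simp: field_differentiable_def)
  next
    assume "g field_differentiable at x"
    then obtain d where "(g has_derivative (*) d) (at x)"
      by (auto simp: field_differentiable_def has_field_derivative_def)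
    then show "\<exists>D. (g has_derivative D) (at x) \<and> (\<forall>c v. D (scaleC c v) = scaleC c (D v))"
      by (intro exI[of _ "(*) d"]) (simp add: scaleC_complex_def)
  qed
  then have "hol_germ g \<longleftrightarrow> (\<exists>S. open S \<and> 0 \<in> S \<and> (\<forall>x\<in>S. g field_differentiable at x))"
    by (simp add: hol_germ_def eventually_nhds)
  also have "\<dots> \<longleftrightarrow> g analytic_on {0}"
    unfolding analytic_at holomorphic_on_def
    by (metis at_within_open)
  finally show ?thesis .
qed

definition map_germ :: "('a::complex_space \<Rightarrow> 'b::complex_space) \<Rightarrow> bool"
  where "map_germ f \<longleftrightarrow> hol_germ f \<and> f 0 = 0"

definition max_ideal :: "('a::complex_space \<Rightarrow> complex) set"
  where "max_ideal = {g. hol_germ g \<and> g 0 = 0}"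

definition biholo_germ :: "('a::complex_space \<Rightarrow> 'a) \<Rightarrow> bool"
  where "biholo_germ h \<longleftrightarrow> map_germ h \<and>
    (\<exists>h'. map_germ h' \<and> (\<forall>\<^sub>F x in nhds 0. h' (h x) = x) \<and> (\<forall>\<^sub>F y in nhds 0. h (h' y) = y))"

(* Vector fields along f; the tangent bundle is trivialised, so f enters only through its type. *)
definition theta :: "('a::complex_space \<Rightarrow> 'b::complex_space) \<Rightarrow> ('a \<Rightarrow> 'b) set"
  where "theta f = {\<zeta>. hol_germ \<zeta>}"

(* df(theta_n) + {\<eta> o f : \<eta> in theta_p} *)
definition Ae_tangent :: "('a::complex_space \<Rightarrow> 'b::complex_space) \<Rightarrow> ('a \<Rightarrow> 'b) set"
  where "Ae_tangent f = {\<zeta> \<in> theta f. \<exists>\<xi> :: 'a \<Rightarrow> 'a. \<exists>\<eta> :: 'b \<Rightarrow> 'b. hol_germ \<xi> \<and> hol_germ \<eta> \<and>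
    (\<forall>\<^sub>F x in nhds 0. \<zeta> x = frechet_derivative f (at x) (\<xi> x) + \<eta> (f x))}"

(* The complex vector space V / W has a basis with k elements, namely the classes of e 0, ...,
   e (k - 1). In the use below W contains every function vanishing near 0, so passing from
   functions to germs does not change the quotient. *)
definition quotient_has_dim :: "('a \<Rightarrow> 'b::complex_space) set \<Rightarrow> ('a \<Rightarrow> 'b) set \<Rightarrow> nat \<Rightarrow> bool"
  where "quotient_has_dim V W k \<longleftrightarrow> (\<exists>e :: nat \<Rightarrow> 'a \<Rightarrow> 'b.
    (\<forall>i<k. e i \<in> V) \<and>
    (\<forall>\<zeta>\<in>V. \<exists>c :: nat \<Rightarrow> complex. (\<lambda>x. \<zeta> x - (\<Sum>i<k. scaleC (c i) (e i x))) \<in> W) \<and>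
    (\<forall>c :: nat \<Rightarrow> complex. (\<lambda>x. \<Sum>i<k. scaleC (c i) (e i x)) \<in> W \<longrightarrow> (\<forall>i<k. c i = 0)))"

(* In particular, the codimension is finite. *)
definition has_Ae_codim :: "('a::complex_space \<Rightarrow> 'b::complex_space) \<Rightarrow> nat \<Rightarrow> bool"
  where "has_Ae_codim f k \<longleftrightarrow> quotient_has_dim (theta f) (Ae_tangent f) k"

definition stable_germ :: "('a::complex_space \<Rightarrow> 'b::complex_space) \<Rightarrow> bool"
  where "stable_germ f \<longleftrightarrow> map_germ f \<and> has_Ae_codim f 0"

definition opsu ::
  "('a::complex_space \<Rightarrow> 'b::complex_space) \<Rightarrow> ('a \<times> complex \<Rightarrow> 'b \<times> complex) \<Rightarrow> bool"
  where "opsu f F \<longleftrightarrow> stable_germ F \<and>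
    (\<forall>\<^sub>F z in nhds 0. snd (F z) = snd z) \<and> (\<forall>\<^sub>F x in nhds 0. fst (F (x, 0)) = f x)"

definition phi_equivalent ::
  "('a::complex_space \<times> complex \<Rightarrow> 'b::complex_space \<times> complex) \<Rightarrow>
   ('a \<times> complex \<Rightarrow> 'b \<times> complex) \<Rightarrow> bool"
  where "phi_equivalent F F' \<longleftrightarrow>
    (\<exists>h k l. biholo_germ h \<and> biholo_germ k \<and> biholo_germ l \<and>
       (\<forall>\<^sub>F z in nhds 0. F' (h z) = k (F z)) \<and> (\<forall>\<^sub>F w in nhds 0. snd (k w) = l (snd w)))"

(* The last component of \<Phi> is a multiple, in the ring of germs, of the last coordinate. *)
definition last_comp_multiple :: "('a::complex_space \<times> complex \<Rightarrow> 'a \<times> complex) \<Rightarrow> bool"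
  where "last_comp_multiple \<Phi> \<longleftrightarrow>
    (\<exists>a :: 'a \<times> complex \<Rightarrow> complex. hol_germ a \<and> (\<forall>\<^sub>F z in nhds 0. snd (\<Phi> z) = a z * snd z))"

definition weak_equivalent ::
  "('a::complex_space \<times> complex \<Rightarrow> 'b::complex_space \<times> complex) \<Rightarrow>
   ('a \<times> complex \<Rightarrow> 'b \<times> complex) \<Rightarrow> bool"
  where "weak_equivalent F G \<longleftrightarrow>
    (\<exists>\<Phi> \<Psi>. biholo_germ \<Phi> \<and> biholo_germ \<Psi> \<and> (\<forall>\<^sub>F z in nhds 0. G (\<Phi> z) = \<Psi> (F z)) \<and>
       last_comp_multiple \<Phi> \<and> last_comp_multiple \<Psi>)"

definition monomial :: "('n \<Rightarrow> nat) \<Rightarrow> complex ^ 'n::finite \<Rightarrow> complex"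
  where "monomial \<alpha> x = (\<Prod>i\<in>UNIV. (x $ i) ^ \<alpha> i)"

definition last_index :: "'p::{finite,linorder}"
  where "last_index = Max UNIV"

definition indep_of_last :: "(complex ^ 'p::{finite,linorder} \<Rightarrow> complex) \<Rightarrow> bool"
  where "indep_of_last s \<longleftrightarrow> (\<exists>U. open U \<and> 0 \<in> U \<and>
    (\<forall>X\<in>U. \<forall>Y\<in>U. (\<forall>i. i \<noteq> last_index \<longrightarrow> X $ i = Y $ i) \<longrightarrow> s X = s Y))"

end

theory Submission
  imports Defs "HOL-Complex_Analysis.Cauchy_Integral_Formula"
begin

text \<open>
  Put \<open>u(x,\<lambda>) = 1 + \<Sum>\<^sub>i q\<^sub>i(\<lambda>) s\<^sub>i(f x)\<close>, \<open>G = (f + \<lambda>u\<gamma>, \<lambda>)\<close> and \<open>F\<^sub>0 = (f + \<lambda>\<gamma>, \<lambda>)\<close>. With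
  \<open>\<Phi>(x,\<lambda>) = (x, \<lambda>u(x,\<lambda>))\<close> and \<open>\<Psi>(X,\<Lambda>) = (X, \<Lambda>(1 + \<Sum>\<^sub>i q\<^sub>i(\<Lambda>) s\<^sub>i(X)))\<close> one has
  \<open>F\<^sub>0 \<circ> \<Phi> = \<Psi> \<circ> G\<close>, because \<open>f\<close> and \<open>f + \<lambda>u\<gamma>\<close> differ only in the last coordinate, which
  the \<open>s\<^sub>i\<close> do not see. Hence every normal form \<open>G\<close> is weak equivalent to \<open>F\<^sub>0\<close>. Moreover a
  \<open>\<phi>\<close>-equivalence of 1-parameter stable unfoldings is a weak equivalence: both last
  components are given by the germ \<open>l\<close>, which is a multiple of the parameter.
\<close>

subsection \<open>Holomorphic germs\<close>

text \<open>Pointwise form of the condition inside \<open>hol_germ\<close>: closure properties are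
  proved at one point and then transferred to germs with \<open>eventually_elim\<close>.\<close>

definition hol_at :: "('a::complex_space \<Rightarrow> 'b::complex_space) \<Rightarrow> 'a \<Rightarrow> bool"
  where "hol_at g x \<longleftrightarrow>
    (\<exists>D. (g has_derivative D) (at x) \<and> (\<forall>c v. D (scaleC c v) = scaleC c (D v)))"

lemma hol_germ_iff: "hol_germ g \<longleftrightarrow> (\<forall>\<^sub>F x in nhds 0. hol_at g x)"
  by (simp add: hol_germ_def hol_at_def)

lemma hol_at_isCont: "hol_at g x \<Longrightarrow> isCont g x"
  by (auto simp: hol_at_def dest: has_derivative_continuous)

lemma hol_germ_hol_at_0: "hol_germ g \<Longrightarrow> hol_at g 0"
  unfolding hol_germ_iff by (rule eventually_nhds_x_imp_x)

lemma hol_germ_tendsto: "hol_germ g \<Longrightarrow> (g \<longlongrightarrow> g 0) (nhds 0)"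
  using hol_at_isCont[OF hol_germ_hol_at_0] by (simp add: isCont_def tendsto_at_iff_tendsto_nhds)

lemma map_germ_filterlim: "map_germ g \<Longrightarrow> filterlim g (nhds 0) (nhds 0)"
  using hol_germ_tendsto[of g] by (simp add: map_germ_def)

text \<open>Identities of germs hold only on some neighbourhood of the origin. A germ fixing the
  origin is continuous there, so such an identity can be pulled back along it.\<close>

lemma eventually_map_germ:
  assumes "map_germ g" "\<forall>\<^sub>F x in nhds 0. P x"
  shows "\<forall>\<^sub>F x in nhds 0. P (g x)"
  using assms(2) map_germ_filterlim[OF assms(1)] by (rule eventually_compose_filterlim)

lemma scaleC_zero_right: "scaleC c (0::'a::complex_space) = 0"
  using scaleC_add_right[of c "0::'a" 0] by simp

lemma hol_at_const: "hol_at (\<lambda>_. c) x"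
  unfolding hol_at_def by (intro exI[of _ "\<lambda>_. 0"]) (simp add: scaleC_zero_right)

lemma hol_at_id: "hol_at (\<lambda>x. x) x"
  unfolding hol_at_def by (intro exI[of _ "\<lambda>x. x"]) simp

lemma hol_at_fst: "hol_at fst x"
  unfolding hol_at_def
  by (intro exI[of _ fst]) (auto simp: scaleC_prod_def intro!: has_derivative_fst)

lemma hol_at_snd: "hol_at snd x"
  unfolding hol_at_def
  by (intro exI[of _ snd]) (auto simp: scaleC_prod_def intro!: has_derivative_snd)

lemma hol_at_compose:
  assumes "hol_at f x" "hol_at g (f x)"
  shows "hol_at (\<lambda>x. g (f x)) x"
proof -
  from assms obtain D E where
    "(f has_derivative D) (at x)" "\<forall>c v. D (scaleC c v) = scaleC c (D v)"
    "(g has_derivative E) (at (f x))" "\<forall>c v. E (scaleC c v) = scaleC c (E v)"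
    unfolding hol_at_def by blast
  then show ?thesis
    unfolding hol_at_def by (intro exI[of _ "\<lambda>v. E (D v)"]) (auto intro: has_derivative_compose)
qed

lemma hol_at_Pair:
  assumes "hol_at f x" "hol_at g x"
  shows "hol_at (\<lambda>x. (f x, g x)) x"
proof -
  from assms obtain D E where
    "(f has_derivative D) (at x)" "\<forall>c v. D (scaleC c v) = scaleC c (D v)"
    "(g has_derivative E) (at x)" "\<forall>c v. E (scaleC c v) = scaleC c (E v)"
    unfolding hol_at_def by blast
  then show ?thesis
    unfolding hol_at_def
    by (intro exI[of _ "\<lambda>v. (D v, E v)"]) (auto simp: scaleC_prod_def intro: has_derivative_Pair)
qed

lemma hol_at_add:
  assumes "hol_at f x" "hol_at g x"
  shows "hol_at (\<lambda>x. f x + g x) x"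
proof -
  from assms obtain D E where
    "(f has_derivative D) (at x)" "\<forall>c v. D (scaleC c v) = scaleC c (D v)"
    "(g has_derivative E) (at x)" "\<forall>c v. E (scaleC c v) = scaleC c (E v)"
    unfolding hol_at_def by blast
  then show ?thesis
    unfolding hol_at_def
    by (intro exI[of _ "\<lambda>v. D v + E v"]) (auto simp: scaleC_add_right intro: has_derivative_add)
qed

lemma hol_at_mult:
  fixes f g :: "'a::complex_space \<Rightarrow> complex"
  assumes "hol_at f x" "hol_at g x"
  shows "hol_at (\<lambda>x. f x * g x) x"
proof -
  from assms obtain D E where
    "(f has_derivative D) (at x)" "\<forall>c v. D (scaleC c v) = scaleC c (D v)"
    "(g has_derivative E) (at x)" "\<forall>c v. E (scaleC c v) = scaleC c (E v)"
    unfolding hol_at_def by blast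
  then have "((\<lambda>x. f x * g x) has_derivative (\<lambda>v. f x * E v + D v * g x)) (at x)"
      "\<forall>c v. f x * E (scaleC c v) + D (scaleC c v) * g x = scaleC c (f x * E v + D v * g x)"
    by (auto simp: scaleC_complex_def distrib_left intro: has_derivative_mult)
  then show ?thesis
    unfolding hol_at_def by blast
qed

lemma hol_at_inverse:
  fixes f :: "'a::complex_space \<Rightarrow> complex"
  assumes "hol_at f x" "f x \<noteq> 0"
  shows "hol_at (\<lambda>x. inverse (f x)) x"
proof -
  from assms obtain D where
    "(f has_derivative D) (at x)" "\<forall>c v. D (scaleC c v) = scaleC c (D v)"
    unfolding hol_at_def by blast
  then have "((\<lambda>x. inverse (f x)) has_derivative
      (\<lambda>v. - (inverse (f x) * D v * inverse (f x)))) (at x)"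
      "\<forall>c v. - (inverse (f x) * D (scaleC c v) * inverse (f x))
        = scaleC c (- (inverse (f x) * D v * inverse (f x)))"
    using assms(2) by (auto simp: scaleC_complex_def intro: has_derivative_inverse)
  then show ?thesis
    unfolding hol_at_def by blast
qed

text \<open>A complex-linear map of the complex line is multiplication by its value at 1. This opens
  the way to one-variable results such as the Cauchy inequality.\<close>

lemma hol_at_field_differentiable:
  fixes g :: "complex \<Rightarrow> complex"
  assumes "hol_at g x"
  shows "g field_differentiable (at x)"
proof -
  from assms obtain D where D: "(g has_derivative D) (at x)" "\<And>c v. D (c * v) = c * D v"
    by (auto simp: hol_at_def scaleC_complex_def)
  have "D v = D 1 * v" for v
    using D(2)[of v 1] by simp
  then have "D = (*) (D 1)"
    by (rule ext)
  with D(1) have "(g has_field_derivative D 1) (at x)"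
    unfolding has_field_derivative_def by simp
  then show ?thesis
    unfolding field_differentiable_def by blast
qed

section \<open>Closure properties of germs, obtained from those at a point\<close>

lemma hol_germ_const: "hol_germ (\<lambda>_. c)"
  by (simp add: hol_germ_iff hol_at_const)

lemma hol_germ_fst: "hol_germ fst"
  by (simp add: hol_germ_iff hol_at_fst)

lemma hol_germ_snd: "hol_germ snd"
  by (simp add: hol_germ_iff hol_at_snd)

lemma hol_germ_compose:
  assumes "map_germ f" "hol_germ g"
  shows "hol_germ (\<lambda>x. g (f x))"
proof -
  have "\<forall>\<^sub>F x in nhds 0. hol_at f x"
    using assms(1) by (simp add: map_germ_def hol_germ_iff)
  moreover have "\<forall>\<^sub>F x in nhds 0. hol_at g (f x)"
    using assms(2) unfolding hol_germ_iff by (rule eventually_map_germ[OF assms(1)])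
  ultimately show ?thesis
    unfolding hol_germ_iff by eventually_elim (rule hol_at_compose)
qed

lemma hol_germ_Pair: "hol_germ f \<Longrightarrow> hol_germ g \<Longrightarrow> hol_germ (\<lambda>x. (f x, g x))"
  unfolding hol_germ_iff by (erule (1) eventually_elim2) (rule hol_at_Pair)

lemma hol_germ_add: "hol_germ f \<Longrightarrow> hol_germ g \<Longrightarrow> hol_germ (\<lambda>x. f x + g x)"
  unfolding hol_germ_iff by (erule (1) eventually_elim2) (rule hol_at_add)

lemma hol_germ_mult:
  fixes f g :: "'a::complex_space \<Rightarrow> complex"
  shows "hol_germ f \<Longrightarrow> hol_germ g \<Longrightarrow> hol_germ (\<lambda>x. f x * g x)"
  unfolding hol_germ_iff by (erule (1) eventually_elim2) (rule hol_at_mult)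

lemma hol_germ_sum:
  "(\<And>i. i \<in> A \<Longrightarrow> hol_germ (f i)) \<Longrightarrow> hol_germ (\<lambda>x. \<Sum>i\<in>A. f i x)"
  by (induction A rule: infinite_finite_induct) (auto intro: hol_germ_const hol_germ_add)

lemma hol_germ_inverse:
  fixes f :: "'a::complex_space \<Rightarrow> complex"
  assumes "hol_germ f" "f 0 \<noteq> 0"
  shows "hol_germ (\<lambda>x. inverse (f x))"
proof -
  have "\<forall>\<^sub>F x in nhds 0. f x \<noteq> 0"
    using hol_germ_tendsto[OF assms(1)] assms(2) by (rule tendsto_imp_eventually_ne)
  with assms(1) show ?thesis
    unfolding hol_germ_iff by eventually_elim (rule hol_at_inverse)
qed

lemma map_germ_compose: "map_germ f \<Longrightarrow> map_germ g \<Longrightarrow> map_germ (\<lambda>x. g (f x))"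
  using hol_germ_compose[of f g] by (simp add: map_germ_def)

lemma map_germ_fst: "map_germ fst"
  by (simp add: map_germ_def hol_germ_fst)

lemma map_germ_snd: "map_germ snd"
  by (simp add: map_germ_def hol_germ_snd)

subsection \<open>Germs of biholomorphisms\<close>

lemma biholo_germ_compose:
  assumes "biholo_germ f" "biholo_germ g"
  shows "biholo_germ (\<lambda>x. g (f x))"
proof -
  from assms obtain f' g' where f: "map_germ f" "map_germ f'"
      "\<forall>\<^sub>F x in nhds 0. f' (f x) = x" "\<forall>\<^sub>F x in nhds 0. f (f' x) = x"
    and g: "map_germ g" "map_germ g'"
      "\<forall>\<^sub>F x in nhds 0. g' (g x) = x" "\<forall>\<^sub>F x in nhds 0. g (g' x) = x"
    unfolding biholo_germ_def by blast
  have "\<forall>\<^sub>F x in nhds 0. f' (g' (g (f x))) = x"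
    using eventually_map_germ[OF f(1) g(3)] f(3) by eventually_elim simp
  moreover have "\<forall>\<^sub>F x in nhds 0. g (f (f' (g' x))) = x"
    using eventually_map_germ[OF g(2) f(4)] g(4) by eventually_elim simp
  ultimately show ?thesis
    unfolding biholo_germ_def using f g
    by (intro conjI exI[of _ "\<lambda>x. f' (g' x)"]) (auto intro: map_germ_compose)
qed

text \<open>Invariance of domain makes the image open, so continuity of \<open>D\<close> in the base
  point does not have to be established. The inverse function theorem for a given inverse then
  yields its derivative at every image point.\<close>

lemma biholo_germ_of_injective:
  fixes \<Phi> :: "'a::complex_space \<Rightarrow> 'a"
  assumes S: "open S" "0 \<in> S" and inj: "inj_on \<Phi> S" and "\<Phi> 0 = 0"
    and D: "\<And>x. x \<in> S \<Longrightarrow> (\<Phi> has_derivative D x) (at x)"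
      "\<And>x c v. x \<in> S \<Longrightarrow> D x (scaleC c v) = scaleC c (D x v)"
      "\<And>x v. x \<in> S \<Longrightarrow> D x v = 0 \<Longrightarrow> v = 0"
  shows "biholo_germ \<Phi>"
proof -
  define \<Phi>' where "\<Phi>' = inv_into S \<Phi>"
  have inv: "\<Phi>' (\<Phi> x) = x" if "x \<in> S" for x
    using that inj by (simp add: \<Phi>'_def)
  have cont: "continuous_on S \<Phi>"
    using D(1) by (meson continuous_at_imp_continuous_on has_derivative_continuous)
  have "hol_at \<Phi> x" if "x \<in> S" for x
    unfolding hol_at_def using D that by blast
  then have 1: "map_germ \<Phi>"
    using S \<open>\<Phi> 0 = 0\<close> unfolding map_germ_def hol_germ_iff eventually_nhds by blast
  have "hol_at \<Phi>' (\<Phi> x)" if x: "x \<in> S" for x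
  proof -
    have lin: "linear (D x)"
      using D(1)[OF x] by (rule has_derivative_linear)
    then have "inj (D x)"
      using D(3)[OF x] by (simp add: linear_injective_0)
    with lin have "surj (D x)"
      by (rule linear_injective_imp_surjective) simp
    \<comment> \<open>The inverse of a complex-linear bijection is complex-linear, so the real
      derivative of \<Phi>' is a complex one.\<close>
    have "inv (D x) (scaleC c v) = scaleC c (inv (D x) v)" for c v
    proof (rule inv_f_eq[OF \<open>inj (D x)\<close>])
      show "D x (scaleC c (inv (D x) v)) = scaleC c v"
        using D(2)[OF x] surj_f_inv_f[OF \<open>surj (D x)\<close>] by simp
    qed
    moreover have "(\<Phi>' has_derivative inv (D x)) (at (\<Phi> x))"
      using S(1) x cont inv D(1)[OF x] surj_iff[THEN iffD1, OF \<open>surj (D x)\<close>]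
      by (rule has_derivative_inverse_strong)
    ultimately show ?thesis
      unfolding hol_at_def by blast
  qed
  moreover have img: "open (\<Phi> ` S)" "0 \<in> \<Phi> ` S"
    using invariance_of_domain[OF cont S(1) inj] S(2) \<open>\<Phi> 0 = 0\<close> by force+
  ultimately have "hol_germ \<Phi>'"
    unfolding hol_germ_iff eventually_nhds by blast
  then have 2: "map_germ \<Phi>'"
    using inv[OF S(2)] \<open>\<Phi> 0 = 0\<close> by (simp add: map_germ_def)
  have "\<forall>\<^sub>F x in nhds 0. \<Phi>' (\<Phi> x) = x"
    using S inv unfolding eventually_nhds by blast
  moreover have "\<forall>\<^sub>F y in nhds 0. \<Phi> (\<Phi>' y) = y"
    using img f_inv_into_f[of _ \<Phi> S] unfolding eventually_nhds \<Phi>'_def by blast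
  ultimately show ?thesis
    using 1 2 unfolding biholo_germ_def by blast
qed

text \<open>
  Applied to \<open>v = u(x,\<cdot>)\<close> and \<open>c = u(0,0)\<close>, uniformly in \<open>x\<close>, this makes \<open>t \<mapsto> t u(x,t)\<close> a small
  Lipschitz perturbation of \<open>t \<mapsto> c t\<close> on a smaller disc: hence injective, with nonzero derivative.
\<close>
lemma scaled_parameter_bound:
  fixes v :: "complex \<Rightarrow> complex"
  assumes "0 < r" and hol: "\<And>t. t \<in> ball 0 r \<Longrightarrow> v field_differentiable (at t)"
    and bound: "\<And>t. t \<in> ball 0 r \<Longrightarrow> cmod (v t - c) \<le> cmod c / 8"
    and t: "t \<in> ball 0 (r/4)"
  shows "cmod (deriv (\<lambda>t. t * (v t - c)) t) \<le> cmod c / 4"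
proof -
  let ?w = "\<lambda>t. t * (v t - c)"
  \<comment> \<open>On the circle of radius \<open>r/4\<close> about \<open>t\<close> the factor
    \<open>s\<close> is thus at most \<open>r/2\<close> in modulus.\<close>
  have sub: "cball t (r/4) \<subseteq> ball 0 (r/2)"
  proof
    fix s assume "s \<in> cball t (r/4)"
    then have "cmod s \<le> cmod t + r/4"
      using norm_triangle_ineq2[of s t] by (simp add: dist_norm norm_minus_commute)
    with t show "s \<in> ball 0 (r/2)" by simp
  qed
  have fd: "?w field_differentiable (at s)" if "s \<in> ball 0 r" for s
    using hol[OF that] by (intro derivative_intros) auto
  have "?w holomorphic_on ball 0 r"
    unfolding holomorphic_on_def using fd by (auto intro: field_differentiable_at_within)
  moreover have "cball t (r/4) \<subseteq> ball 0 r"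
    using sub \<open>0 < r\<close> by (auto simp: subset_iff)
  ultimately have hol': "?w holomorphic_on cball t (r/4)"
    by (rule holomorphic_on_subset)
  \<comment> \<open>On that circle the product is at most \<open>(r/2) * (cmod c / 8)\<close>;
    division by the radius \<open>r/4\<close> leaves \<open>cmod c / 4\<close>.\<close>
  have "cmod ((deriv ^^ 1) ?w t) \<le> fact 1 * ((r/2) * (cmod c / 8)) / (r/4) ^ 1"
  proof (rule Cauchy_inequality)
    show "?w holomorphic_on ball t (r/4)"
      using hol' by (rule holomorphic_on_subset) auto
    show "continuous_on (cball t (r/4)) ?w"
      using hol' by (rule holomorphic_on_imp_continuous_on)
    show "0 < r/4" using \<open>0 < r\<close> by simp
    fix s assume "cmod (t - s) = r/4"
    then have "s \<in> cball t (r/4)" by (simp add: dist_norm)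
    with sub have "s \<in> ball 0 (r/2)" by blast
    then have "cmod s \<le> r/2" "cmod (v s - c) \<le> cmod c / 8"
      using bound[of s] \<open>0 < r\<close> by auto
    then show "cmod (?w s) \<le> (r/2) * (cmod c / 8)"
      unfolding norm_mult using \<open>0 < r\<close> by (intro mult_mono) auto
  qed
  with \<open>0 < r\<close> show ?thesis by simp
qed

text \<open>The first component is fixed, so only the slices
  \<open>t * u (x, t) = c * t + t * (u (x, t) - c)\<close> with \<open>c = u 0\<close> matter. The
  derivative of the second summand is at most a quarter of \<open>cmod c\<close>, uniformly in
  \<open>x\<close>, so it can destroy neither injectivity nor invertibility of the
  derivative.\<close>

lemma biholo_germ_scaled_parameter:
  fixes u :: "'a::complex_space \<times> complex \<Rightarrow> complex"
  assumes "hol_germ u" "u 0 \<noteq> 0"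
  shows "biholo_germ (\<lambda>z. (fst z, u z * snd z))"
proof -
  let ?\<Phi> = "\<lambda>z. (fst z, u z * snd z)"
  define c where "c = u 0"
  have "c \<noteq> 0" using assms(2) by (simp add: c_def)
  \<comment> \<open>The tolerance \<open>cmod c / 8\<close> is the one that the Cauchy estimate
    turns into \<open>cmod c / 4\<close>.\<close>
  then have "\<forall>\<^sub>F z in nhds 0. dist (u z) c < cmod c / 8"
    unfolding c_def by (intro tendstoD[OF hol_germ_tendsto[OF assms(1)]]) simp
  with assms(1) have "\<forall>\<^sub>F z in nhds 0. hol_at u z \<and> cmod (u z - c) \<le> cmod c / 8"
    unfolding hol_germ_iff by eventually_elim (simp add: dist_norm)
  then obtain e where "e > 0"
    and e: "\<And>z. dist z 0 < e \<Longrightarrow> hol_at u z \<and> cmod (u z - c) \<le> cmod c / 8"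
    unfolding eventually_nhds_metric by blast
  \<comment> \<open>Halving \<open>e\<close> puts the product of two balls of radius
    \<open>r\<close> inside the ball of radius \<open>e\<close>, since the norm of a pair is at most
    the sum of the norms.\<close>
  define r where "r = e/2"
  have "r > 0" using \<open>e > 0\<close> by (simp add: r_def)
  have ur: "hol_at u (x, t)" "cmod (u (x, t) - c) \<le> cmod c / 8"
    if "x \<in> ball 0 r" "t \<in> ball 0 r" for x t
  proof -
    have "dist (x, t) 0 < e"
      using norm_Pair_le[of x t] that by (simp add: r_def)
    then show "hol_at u (x, t)" "cmod (u (x, t) - c) \<le> cmod c / 8"
      using e by blast+
  qed
  have fd: "(\<lambda>t. u (x, t)) field_differentiable (at t)"
    if "x \<in> ball 0 r" "t \<in> ball 0 r" for x t
    using hol_at_compose[OF hol_at_Pair[OF hol_at_const hol_at_id] ur(1)[OF that]]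
    by (rule hol_at_field_differentiable)
  have wbound: "cmod (deriv (\<lambda>t. t * (u (x, t) - c)) t) \<le> cmod c / 4"
    if "x \<in> ball 0 r" "t \<in> ball 0 (r/4)" for x t
    using \<open>r > 0\<close> fd ur(2) that by (intro scaled_parameter_bound[of r]) auto
  have wfd: "(\<lambda>t. t * (u (x, t) - c)) field_differentiable (at t)"
    if "x \<in> ball 0 r" "t \<in> ball 0 (r/4)" for x t
    using that \<open>r > 0\<close> by (intro derivative_intros fd) auto
  \<comment> \<open>The parameter disc has radius \<open>r/4\<close> because \<open>wbound\<close>
    is available only there.\<close>
  define S :: "('a \<times> complex) set" where "S = ball 0 r \<times> ball 0 (r/4)"
  have inj: "inj_on ?\<Phi> S"
  proof (rule inj_onI)
    fix z z' assume z: "z \<in> S" "z' \<in> S" and eq: "?\<Phi> z = ?\<Phi> z'"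
    obtain x t where zt: "z = (x, t)" by (cases z)
    with eq obtain t' where zt': "z' = (x, t')" by (cases z') auto
    have x: "x \<in> ball 0 r" "t \<in> ball 0 (r/4)" "t' \<in> ball 0 (r/4)"
      using z by (auto simp: S_def zt zt')
    have "cmod (t * (u (x, t) - c) - t' * (u (x, t') - c)) \<le> cmod c / 4 * cmod (t - t')"
    proof (rule field_differentiable_bound[of "ball 0 (r/4)"])
      fix s :: complex assume s: "s \<in> ball 0 (r/4)"
      show "((\<lambda>t. t * (u (x, t) - c)) has_field_derivative deriv (\<lambda>t. t * (u (x, t) - c)) s)
          (at s within ball 0 (r/4))"
        using wfd[OF x(1) s] field_differentiable_derivI has_field_derivative_at_within by blast
      show "cmod (deriv (\<lambda>t. t * (u (x, t) - c)) s) \<le> cmod c / 4"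
        by (rule wbound[OF x(1) s])
    qed (use x in auto)
    \<comment> \<open>Equality of the images cancels the terms \<open>t * u (x, t)\<close> and
      \<open>t' * u (x, t')\<close>. What remains has Lipschitz constant \<open>cmod c\<close>,
      against the bound \<open>cmod c / 4\<close> just obtained from the mean value
      inequality.\<close>
    moreover have "t * (u (x, t) - c) - t' * (u (x, t') - c) = c * (t' - t)"
      using eq by (simp add: zt zt' algebra_simps)
    ultimately have "cmod c * cmod (t' - t) \<le> cmod c / 4 * cmod (t' - t)"
      by (simp add: norm_mult norm_minus_commute)
    then have "cmod c * cmod (t' - t) \<le> 0"
      by simp
    with \<open>c \<noteq> 0\<close> have "t' = t"
      by (simp add: mult_le_0_iff)
    then show "z = z'" by (simp add: zt zt')
  qed
  have "\<exists>D. (?\<Phi> has_derivative D) (at z) \<and> (\<forall>c v. D (scaleC c v) = scaleC c (D v)) \<and>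
      (\<forall>v. D v = 0 \<longrightarrow> v = 0)" if "z \<in> S" for z
  proof -
    obtain x t where zt: "z = (x, t)" by (cases z)
    with that have x: "x \<in> ball 0 r" "t \<in> ball 0 (r/4)" "t \<in> ball 0 r"
      using \<open>r > 0\<close> by (auto simp: S_def)
    obtain D where D: "(u has_derivative D) (at z)" "\<And>c v. D (scaleC c v) = scaleC c (D v)"
      using ur(1)[OF x(1,3)] unfolding hol_at_def zt by blast
    let ?E = "\<lambda>v. (fst v, u z * snd v + D v * snd z)"
    have "(?\<Phi> has_derivative ?E) (at z)"
      using D(1) by (auto intro!: derivative_eq_intros)
    moreover have "?E (scaleC a v) = scaleC a (?E v)" for a v
      using D(2) by (simp add: scaleC_prod_def scaleC_complex_def algebra_simps)
    \<comment> \<open>A kernel vector points in the parameter direction, where \<open>?E\<close>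
      acts as multiplication by \<open>u z + t * D (0, 1)\<close>, the derivative of
      \<open>t * u (x, t)\<close> in \<open>t\<close>.\<close>
    moreover have "v = 0" if "?E v = 0" for v
    proof -
      from that have v: "v = (0, snd v)" and 0: "u z * snd v + D v * snd z = 0"
        by (auto simp: prod_eq_iff)
      have "D v = D (scaleC (snd v) (0, 1))"
        by (subst v) (simp add: scaleC_prod_def scaleC_complex_def scaleC_zero_right)
      then have Dv: "D v = snd v * D (0, 1)"
        by (simp add: D(2) scaleC_complex_def)
      have "((\<lambda>t. u (x, t)) has_derivative (\<lambda>s. D (0, s))) (at t)"
        using D(1) has_derivative_Pair[OF has_derivative_const has_derivative_ident]
        unfolding zt by (rule has_derivative_compose[rotated])
      moreover have "D (0, s) = D (0, 1) * s" for s
        using D(2)[of s "(0, 1)"]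
        by (simp add: scaleC_prod_def scaleC_complex_def scaleC_zero_right mult.commute)
      then have "(\<lambda>s. D (0, s)) = (*) (D (0, 1))"
        by (rule ext)
      ultimately have "((\<lambda>t. u (x, t)) has_field_derivative D (0, 1)) (at t)"
        unfolding has_field_derivative_def by simp
      then have "((\<lambda>t. t * (u (x, t) - c)) has_field_derivative (u z - c) + t * D (0, 1)) (at t)"
        by (auto simp: zt algebra_simps intro!: derivative_eq_intros)
      with wbound[OF x(1,2)] have "cmod ((u z - c) + t * D (0, 1)) \<le> cmod c / 4"
        by (metis DERIV_imp_deriv)
      \<comment> \<open>If this vanished, the estimated quantity would equal \<open>- c\<close>, of
        modulus greater than \<open>cmod c / 4\<close>.\<close>
      then have "u z + t * D (0, 1) \<noteq> 0"
        using \<open>c \<noteq> 0\<close> by (auto simp: algebra_simps add_eq_0_iff)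
      moreover have "snd v * (u z + t * D (0, 1)) = 0"
        using 0 by (simp add: Dv zt algebra_simps)
      ultimately show "v = 0"
        using v by (simp add: prod_eq_iff)
    qed
    ultimately show ?thesis by (intro exI[of _ ?E]) blast
  qed
  then have "\<forall>z\<in>S. \<exists>D. (?\<Phi> has_derivative D) (at z) \<and>
      (\<forall>c v. D (scaleC c v) = scaleC c (D v)) \<and> (\<forall>v. D v = 0 \<longrightarrow> v = 0)"
    by (rule ballI)
  from bchoice[OF this] obtain D where "\<forall>z\<in>S. (?\<Phi> has_derivative D z) (at z) \<and>
      (\<forall>c v. D z (scaleC c v) = scaleC c (D z v)) \<and> (\<forall>v. D z v = 0 \<longrightarrow> v = 0)" ..
  moreover have "open S" "0 \<in> S"
    using \<open>r > 0\<close> by (auto simp: S_def open_Times zero_prod_def)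
  ultimately show ?thesis
    using inj by (intro biholo_germ_of_injective[of S _ D]) (auto simp: zero_prod_def)
qed

subsection \<open>Weak equivalence\<close>

lemma last_comp_multiple_compose:
  assumes "map_germ \<Phi>" "last_comp_multiple \<Phi>" "last_comp_multiple \<Psi>"
  shows "last_comp_multiple (\<lambda>z. \<Psi> (\<Phi> z))"
proof -
  from assms obtain a b where a: "hol_germ a" "\<forall>\<^sub>F z in nhds 0. snd (\<Phi> z) = a z * snd z"
    and b: "hol_germ b" "\<forall>\<^sub>F z in nhds 0. snd (\<Psi> z) = b z * snd z"
    unfolding last_comp_multiple_def by blast
  have "\<forall>\<^sub>F z in nhds 0. snd (\<Psi> (\<Phi> z)) = (b (\<Phi> z) * a z) * snd z"
    using eventually_map_germ[OF assms(1) b(2)] a(2) by eventually_elim simp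
  moreover have "hol_germ (\<lambda>z. b (\<Phi> z) * a z)"
    by (intro hol_germ_mult hol_germ_compose[OF assms(1)] a(1) b(1))
  ultimately show ?thesis
    unfolding last_comp_multiple_def by blast
qed

text \<open>Near the origin \<open>snd y = a (\<Phi>' y) * snd (\<Phi>' y)\<close>, so it suffices
  to divide by the first factor. If \<open>a 0 = 0\<close>, the right side would be a product of two
  germs vanishing at the origin and have derivative zero there, unlike \<open>snd\<close>.\<close>

lemma last_comp_multiple_inverse:
  assumes "map_germ \<Phi>" "map_germ \<Phi>'" "\<forall>\<^sub>F z in nhds 0. \<Phi> (\<Phi>' z) = z" "last_comp_multiple \<Phi>"
  shows "last_comp_multiple \<Phi>'"
proof -
  from assms(4) obtain a where a: "hol_germ a" "\<forall>\<^sub>F z in nhds 0. snd (\<Phi> z) = a z * snd z"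
    unfolding last_comp_multiple_def by blast
  have ev: "\<forall>\<^sub>F y in nhds 0. snd y = a (\<Phi>' y) * snd (\<Phi>' y)"
    using eventually_map_germ[OF assms(2) a(2)] assms(3) by eventually_elim simp
  have "a 0 \<noteq> 0"
  proof
    assume "a 0 = 0"
    obtain A E where A: "((\<lambda>y. a (\<Phi>' y)) has_derivative A) (at 0)"
      and E: "((\<lambda>y. snd (\<Phi>' y)) has_derivative E) (at 0)"
      using hol_germ_hol_at_0 hol_germ_compose[OF assms(2)] a(1) hol_germ_snd
      unfolding hol_at_def by metis
    have "((\<lambda>y. a (\<Phi>' y) * snd (\<Phi>' y)) has_derivative (\<lambda>_. 0)) (at 0)"
      using has_derivative_mult[OF A E] assms(2) \<open>a 0 = 0\<close> by (simp add: map_germ_def)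
    moreover have "((\<lambda>y. a (\<Phi>' y) * snd (\<Phi>' y)) has_derivative snd) (at 0)"
    proof (rule has_derivative_transform_eventually)
      show "(snd has_derivative snd) (at 0)"
        by (auto intro!: has_derivative_snd)
      show "\<forall>\<^sub>F y in at 0. snd y = a (\<Phi>' y) * snd (\<Phi>' y)"
        using ev by (simp add: eventually_at_filter eventually_mono)
    qed (use assms(2) in \<open>simp_all add: map_germ_def\<close>)
    ultimately have "snd = (\<lambda>_::'a \<times> complex. 0::complex)"
      by (rule has_derivative_unique[rotated])
    from fun_cong[OF this, of "(0, 1)"] show False by simp
  qed
  then have h: "hol_germ (\<lambda>y. inverse (a (\<Phi>' y)))"
    using hol_germ_compose[OF assms(2) a(1)] assms(2)
    by (intro hol_germ_inverse) (auto simp: map_germ_def)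
  have "\<forall>\<^sub>F y in nhds 0. a (\<Phi>' y) \<noteq> 0"
    using hol_germ_tendsto[OF hol_germ_compose[OF assms(2) a(1)]] \<open>a 0 \<noteq> 0\<close> assms(2)
    by (intro tendsto_imp_eventually_ne) (auto simp: map_germ_def)
  with ev have "\<forall>\<^sub>F y in nhds 0. snd (\<Phi>' y) = inverse (a (\<Phi>' y)) * snd y"
    by eventually_elim (simp add: field_simps)
  with h show ?thesis
    unfolding last_comp_multiple_def by blast
qed

lemma weak_equivalent_trans:
  assumes "map_germ F" "weak_equivalent F G" "weak_equivalent G H"
  shows "weak_equivalent F H"
proof -
  from assms(2) obtain \<Phi> \<Psi> where 1: "biholo_germ \<Phi>" "biholo_germ \<Psi>"
      "\<forall>\<^sub>F z in nhds 0. G (\<Phi> z) = \<Psi> (F z)" "last_comp_multiple \<Phi>" "last_comp_multiple \<Psi>"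
    unfolding weak_equivalent_def by blast
  from assms(3) obtain \<Phi>' \<Psi>' where 2: "biholo_germ \<Phi>'" "biholo_germ \<Psi>'"
      "\<forall>\<^sub>F z in nhds 0. H (\<Phi>' z) = \<Psi>' (G z)" "last_comp_multiple \<Phi>'" "last_comp_multiple \<Psi>'"
    unfolding weak_equivalent_def by blast
  have m: "map_germ \<Phi>" "map_germ \<Psi>"
    using 1 by (auto simp: biholo_germ_def)
  have "\<forall>\<^sub>F z in nhds 0. H (\<Phi>' (\<Phi> z)) = \<Psi>' (\<Psi> (F z))"
    using eventually_map_germ[OF m(1) 2(3)] 1(3) by eventually_elim simp
  then show ?thesis
    unfolding weak_equivalent_def using 1 2 m
    by (intro exI[of _ "\<lambda>z. \<Phi>' (\<Phi> z)"] exI[of _ "\<lambda>z. \<Psi>' (\<Psi> z)"] conjI)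
      (auto intro: biholo_germ_compose last_comp_multiple_compose)
qed

lemma weak_equivalent_sym:
  assumes "map_germ F" "weak_equivalent F G"
  shows "weak_equivalent G F"
proof -
  from assms(2) obtain \<Phi> \<Psi> where 1: "biholo_germ \<Phi>" "biholo_germ \<Psi>"
      "\<forall>\<^sub>F z in nhds 0. G (\<Phi> z) = \<Psi> (F z)" "last_comp_multiple \<Phi>" "last_comp_multiple \<Psi>"
    unfolding weak_equivalent_def by blast
  obtain \<Phi>' where \<Phi>: "map_germ \<Phi>" "map_germ \<Phi>'" "\<forall>\<^sub>F z in nhds 0. \<Phi>' (\<Phi> z) = z"
      "\<forall>\<^sub>F z in nhds 0. \<Phi> (\<Phi>' z) = z"
    using 1(1) unfolding biholo_germ_def by blast
  obtain \<Psi>' where \<Psi>: "map_germ \<Psi>" "map_germ \<Psi>'" "\<forall>\<^sub>F z in nhds 0. \<Psi>' (\<Psi> z) = z"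
      "\<forall>\<^sub>F z in nhds 0. \<Psi> (\<Psi>' z) = z"
    using 1(2) unfolding biholo_germ_def by blast
  \<comment> \<open>The identity for \<Psi>' and \<Psi> is pulled back first along \<open>F\<close>,
    then along \<Phi>'; here \<open>F\<close> must fix the origin and be continuous there.\<close>
  have "\<forall>\<^sub>F z in nhds 0. \<Psi>' (\<Psi> (F (\<Phi>' z))) = F (\<Phi>' z)"
    using eventually_map_germ[OF \<Phi>(2) eventually_map_germ[OF assms(1) \<Psi>(3)]] .
  with eventually_map_germ[OF \<Phi>(2) 1(3)] \<Phi>(4)
  have "\<forall>\<^sub>F z in nhds 0. F (\<Phi>' z) = \<Psi>' (G z)"
    by eventually_elim simp
  moreover have "biholo_germ \<Phi>'" "biholo_germ \<Psi>'"
    using \<Phi> \<Psi> unfolding biholo_germ_def by blast+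
  moreover have "last_comp_multiple \<Phi>'" "last_comp_multiple \<Psi>'"
    using last_comp_multiple_inverse \<Phi> \<Psi> 1 by blast+
  ultimately show ?thesis
    unfolding weak_equivalent_def by blast
qed

section \<open>From phi-equivalence to weak equivalence\<close>

text \<open>The quotient of \<open>l t\<close> by \<open>t\<close> has a removable singularity at 0,
  where its value is the derivative of \<open>l\<close>.\<close>

lemma map_germ_complex_multiple:
  fixes l :: "complex \<Rightarrow> complex"
  assumes "map_germ l"
  obtains a where "hol_germ a" "\<And>t. l t = a t * t"
proof
  let ?a = "\<lambda>t. if t = 0 then deriv l 0 else (l t - l 0) / (t - 0)"
  have "l analytic_on {0}"
    using assms by (simp add: map_germ_def hol_germ_complex_iff_analytic)
  then obtain S where "open S" "0 \<in> S" "l holomorphic_on S"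
    unfolding analytic_at by blast
  then have "?a holomorphic_on S"
    by (intro pole_lemma) (auto simp: interior_open)
  then show "hol_germ ?a"
    using \<open>open S\<close> \<open>0 \<in> S\<close> unfolding hol_germ_complex_iff_analytic analytic_at by blast
  show "l t = ?a t * t" for t
    using assms by (simp add: map_germ_def)
qed

lemma phi_equivalent_imp_weak_equivalent:
  assumes "opsu f F" "opsu g G" "phi_equivalent F G"
  shows "weak_equivalent F G"
proof -
  from assms(3) obtain h k l where hkl: "biholo_germ h" "biholo_germ k" "biholo_germ l"
      "\<forall>\<^sub>F z in nhds 0. G (h z) = k (F z)" "\<forall>\<^sub>F w in nhds 0. snd (k w) = l (snd w)"
    unfolding phi_equivalent_def by blast
  have "map_germ l" "map_germ h"
    using hkl by (auto simp: biholo_germ_def)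
  obtain a where a: "hol_germ a" "\<And>t. l t = a t * t"
    using map_germ_complex_multiple[OF \<open>map_germ l\<close>] by blast
  have F: "map_germ F" "\<forall>\<^sub>F z in nhds 0. snd (F z) = snd z"
    and G: "\<forall>\<^sub>F z in nhds 0. snd (G z) = snd z"
    using assms(1,2) by (auto simp: opsu_def stable_germ_def)
  \<comment> \<open>Both unfoldings preserve the parameter, hence \<open>snd (h z) = snd (G (h z)) =
    snd (k (F z)) = l (snd (F z)) = l (snd z)\<close>.\<close>
  have "\<forall>\<^sub>F z in nhds 0. snd (h z) = a (snd z) * snd z"
    using eventually_map_germ[OF \<open>map_germ h\<close> G] eventually_map_germ[OF F(1) hkl(5)] hkl(4) F(2)
    by eventually_elim (simp flip: a(2))
  moreover have "\<forall>\<^sub>F w in nhds 0. snd (k w) = a (snd w) * snd w"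
    using hkl(5) by (simp add: a(2))
  ultimately have "last_comp_multiple h" "last_comp_multiple k"
    unfolding last_comp_multiple_def using hol_germ_compose[OF map_germ_snd a(1)] by blast+
  with hkl show ?thesis
    unfolding weak_equivalent_def by blast
qed

section \<open>Absorbing a unit factor into the parameter\<close>

text \<open>Both parameters are rescaled by the same target function \<open>w\<close>, in the source
  through \<open>f\<close>. The first components then agree outright, and the last hypothesis is
  exactly the agreement of the factors in the second ones.\<close>

lemma weak_equivalent_scaled_parameter:
  fixes f \<gamma> :: "complex ^ 'n::finite \<Rightarrow> complex ^ 'p::finite"
    and w :: "(complex ^ 'p) \<times> complex \<Rightarrow> complex"
  assumes "map_germ f" "hol_germ w" "w 0 \<noteq> 0"
    and "\<forall>\<^sub>F z in nhds 0. w (f (fst z) + (w (f (fst z), snd z) * snd z) *s \<gamma> (fst z), snd z)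
      = w (f (fst z), snd z)"
  shows "weak_equivalent (\<lambda>(x, t). (f x + (w (f x, t) * t) *s \<gamma> x, t))
    (\<lambda>(x, t). (f x + t *s \<gamma> x, t))"
proof -
  let ?u = "\<lambda>z. w (f (fst z), snd z)"
  have pair: "map_germ (\<lambda>z. (f (fst z), snd z))"
    using map_germ_compose[OF map_germ_fst assms(1)] map_germ_snd
    by (auto simp: map_germ_def zero_prod_def intro: hol_germ_Pair)
  have u: "hol_germ ?u" "?u 0 \<noteq> 0"
    using hol_germ_compose[OF pair assms(2)] assms(1,3) by (auto simp: map_germ_def zero_prod_def)
  show ?thesis
    unfolding weak_equivalent_def
  proof (intro exI conjI)
    show "biholo_germ (\<lambda>z. (fst z, ?u z * snd z))"
      using u by (rule biholo_germ_scaled_parameter)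
    show "biholo_germ (\<lambda>z. (fst z, w z * snd z))"
      using assms(2,3) by (rule biholo_germ_scaled_parameter)
    show "last_comp_multiple (\<lambda>z. (fst z, ?u z * snd z))"
      unfolding last_comp_multiple_def using u(1) by auto
    show "last_comp_multiple (\<lambda>z. (fst z, w z * snd z))"
      unfolding last_comp_multiple_def using assms(2) by auto
    show "\<forall>\<^sub>F z in nhds 0. (\<lambda>(x, t). (f x + t *s \<gamma> x, t)) (fst z, ?u z * snd z) =
        (\<lambda>z. (fst z, w z * snd z)) ((\<lambda>(x, t). (f x + (w (f x, t) * t) *s \<gamma> x, t)) z)"
      using assms(4) by eventually_elim (simp add: case_prod_beta)
  qed
qed

text \<open>Independence is available only inside some neighbourhood \<open>U\<close>, so both
  arguments must eventually enter it.\<close>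

lemma indep_of_last_eventually:
  fixes a b :: "'a::topological_space \<Rightarrow> complex ^ 'p::{finite,linorder}"
  assumes "indep_of_last s" "filterlim a (nhds 0) F" "filterlim b (nhds 0) F"
    and "\<And>z i. i \<noteq> last_index \<Longrightarrow> a z $ i = b z $ i"
  shows "\<forall>\<^sub>F z in F. s (a z) = s (b z)"
proof -
  from assms(1) obtain U where "open U" "0 \<in> U"
    and U: "\<And>X Y. X \<in> U \<Longrightarrow> Y \<in> U \<Longrightarrow> (\<And>i. i \<noteq> last_index \<Longrightarrow> X $ i = Y $ i) \<Longrightarrow> s X = s Y"
    unfolding indep_of_last_def by blast
  have "\<forall>\<^sub>F z in F. a z \<in> U" "\<forall>\<^sub>F z in F. b z \<in> U"
    using assms(2,3) \<open>open U\<close> \<open>0 \<in> U\<close> by (auto dest: topological_tendstoD)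
  then show ?thesis
    by eventually_elim (use U assms(4) in blast)
qed

section \<open>Comparison of all unfoldings with the given one\<close>

theorem proposition6p3:
  fixes f :: "complex ^ 'n::finite \<Rightarrow> complex ^ 'p::{finite,linorder}"
    and k :: nat
    and \<alpha> :: "'n \<Rightarrow> nat"
    and \<gamma> :: "complex ^ 'n \<Rightarrow> complex ^ 'p::{finite,linorder}"
    and s :: "nat \<Rightarrow> complex ^ 'p::{finite,linorder} \<Rightarrow> complex"
  assumes "map_germ f"
    and "has_Ae_codim f k"
    and "monomial \<alpha> \<in> max_ideal"
    and "\<gamma> = (\<lambda>x. axis last_index (monomial \<alpha> x))"
    and "opsu f (\<lambda>(x, t). (f x + t *s \<gamma> x, t))"
    and "\<forall>i\<in>{1..k-1}. s i \<in> max_ideal \<and> indep_of_last (s i)"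
    and "\<forall>F. opsu f F \<longrightarrow>
           (\<exists>q :: nat \<Rightarrow> complex \<Rightarrow> complex. (\<forall>i\<in>{1..k-1}. hol_germ (q i)) \<and>
              (let G = (\<lambda>(x, t). (f x + ((1 + (\<Sum>i\<in>{1..k-1}. q i t * s i (f x))) * t) *s \<gamma> x, t))
               in opsu f G \<and> phi_equivalent F G))"
  shows "\<forall>F G. opsu f F \<and> opsu f G \<longrightarrow> weak_equivalent F G"
proof -
  let ?F\<^sub>0 = "\<lambda>(x, t). (f x + t *s \<gamma> x, t)"
  note f = assms(1)
  have weak: "weak_equivalent F ?F\<^sub>0" if F: "opsu f F" for F
  proof -
    from assms(7) F obtain q where q: "\<forall>i\<in>{1..k-1}. hol_germ (q i)"
      and *: "let G = (\<lambda>(x, t). (f x + ((1 + (\<Sum>i\<in>{1..k-1}. q i t * s i (f x))) * t) *s \<gamma> x, t))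
         in opsu f G \<and> phi_equivalent F G"
      by blast
    \<comment> \<open>Taken as a function on the target, \<open>w\<close> can serve on both sides.
      At the origin it equals 1, since every \<open>s i\<close> vanishes there.\<close>
    define w where "w = (\<lambda>z. 1 + (\<Sum>i\<in>{1..k-1}. q i (snd z) * s i (fst z)))"
    let ?G = "\<lambda>(x, t). (f x + (w (f x, t) * t) *s \<gamma> x, t)"
    have G: "opsu f ?G" "phi_equivalent F ?G"
      using * by (simp_all add: w_def Let_def)
    have s: "hol_germ (s i)" "s i 0 = 0" "indep_of_last (s i)" if "i \<in> {1..k-1}" for i
      using assms(6) that by (auto simp: max_ideal_def)
    have "hol_germ w"
      unfolding w_def using q s(1)
      by (intro hol_germ_add hol_germ_const hol_germ_sum hol_germ_mult
          hol_germ_compose[OF map_germ_snd] hol_germ_compose[OF map_germ_fst]) auto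
    moreover have "w 0 \<noteq> 0"
      using s(2) by (simp add: w_def)
    moreover have "\<forall>\<^sub>F z in nhds 0.
        w (f (fst z) + (w (f (fst z), snd z) * snd z) *s \<gamma> (fst z), snd z) = w (f (fst z), snd z)"
    proof -
      let ?a = "\<lambda>z. f (fst z) + (w (f (fst z), snd z) * snd z) *s \<gamma> (fst z)"
      \<comment> \<open>That \<open>?a\<close> tends to 0 is read off from \<open>?G\<close> being
        an unfolding. It differs from \<open>f (fst z)\<close> by a multiple of \<gamma>, thus only
        in the last coordinate.\<close>
      have "map_germ ?G"
        using G(1) by (simp add: opsu_def stable_germ_def)
      from map_germ_compose[OF this map_germ_fst] have "map_germ ?a"
        by (simp add: case_prod_beta)
      moreover have "map_germ (\<lambda>z. f (fst z))"
        by (rule map_germ_compose[OF map_germ_fst f])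
      ultimately have "\<forall>\<^sub>F z in nhds 0. s i (?a z) = s i (f (fst z))" if "i \<in> {1..k-1}" for i
        using s(3)[OF that]
        by (intro indep_of_last_eventually map_germ_filterlim) (auto simp: assms(4) axis_def)
      \<comment> \<open>There are finitely many indices, so one neighbourhood serves them
        all.\<close>
      then have "\<forall>\<^sub>F z in nhds 0. \<forall>i\<in>{1..k-1}. s i (?a z) = s i (f (fst z))"
        by (intro eventually_ball_finite) auto
      then show ?thesis
        by eventually_elim (simp add: w_def)
    qed
    ultimately have normal_form: "weak_equivalent ?G ?F\<^sub>0"
      by (rule weak_equivalent_scaled_parameter[OF f])
    have "map_germ F"
      using F by (simp add: opsu_def stable_germ_def)
    then show ?thesis
      using phi_equivalent_imp_weak_equivalent[OF F G] normal_form by (rule weak_equivalent_trans)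
  qed
  show ?thesis
  proof (intro allI impI)
    fix F G assume "opsu f F \<and> opsu f G"
    then have "map_germ F" "map_germ G" "weak_equivalent F ?F\<^sub>0" "weak_equivalent G ?F\<^sub>0"
      by (auto simp: opsu_def stable_germ_def weak)
    then show "weak_equivalent F G"
      by (intro weak_equivalent_trans[of F ?F\<^sub>0 G] weak_equivalent_sym[of G ?F\<^sub>0])
  qed
qed

end
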